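(* For every LLEE-witness $\hat{\mathcal{C}}$ of a chart $\mathcal{C}$, the extraction function $s_{\hat{\mathcal{C}}}$ of $\hat{\mathcal{C}}$ is a provable solution of $\mathcal{C}$.
   Context: **Star expressions and $\mathsf{BBP}$.** Given a set $A$ of actions, $StExp(A)$ is generated by $e ::= 0 \mid a \mid (e_1+e_2) \mid (e_1\cdot e_2) \mid (e_1^{\circledast} e_2)$ with $a\in A$. $\sum_{i=1}^k e_i$ is $0$ if $k=0$, $e_1$ if $k=1$, and $(\sum_{i=1}^{k-1}e_i)+e_k$ if $k>1$. $e_1=_{\mathsf{BBP}}e_2$ means that $e_1=e_2$ is derivable by equational logic from (B1) $x+y=y+x$; (B2) $(x+y)+z=x+(y+z)$; (B3) $x+x=x$; (B4) $(x+y)\cdot z=x\cdot z+y\cdot z$; (B5) $(x\cdot y)\cdot z=x\cdot(y\cdot z)$; (B6) $x+0=x$; (B7) $0\cdot x=0$; (BKS1) $x\cdot(x^{\circledast}y)+y=x^{\circledast}y$; (BKS2) $(x^{\circledast}y)\cdot z=x^{\circledast}(y\cdot z)$; and the rule ($\mathrm{RSP}^{\circledast}$): from $x=(y\cdot x)+z$ infer $x=y^{\circledast}z$. **Charts.** A chart is a tuple $\mathcal{C}=\langle V,\sqrt{},v_s,A,T\rangle$ with $V$ a finite set of vertices; $\sqrt{}$ a special symbol which, if $\sqrt{}\in V$, is a vertex without outgoing transitions indicating termination; $v_s\in V\setminus\{\sqrt{}\}$ the start vertex; $T\subseteq V\times A\times V$ a finite set of transitions. Every vertex is reachable from $v_s$.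 **Provable solution.** A function $s:V\setminus\{\sqrt{}\}\to StExp(A)$ such that for all $v\in V\setminus\{\sqrt{}\}$: $s(v)=_{\mathsf{BBP}}(\sum_{i=1}^m a_i)+(\sum_{j=1}^n b_j\cdot s(w_j))$, given that the set of transitions from $v$ is $\{v\xrightarrow{a_i}\sqrt{}\mid 1\le i\le m\}\cup\{v\xrightarrow{b_j}w_j\mid 1\le j\le n,\ w_j\ne\sqrt{}\}$. **LLEE-witness.** A chart is a loop chart if (L1) there is an infinite path from its start vertex; (L2) every infinite path from its start vertex returns to the start vertex after a positive number of transitions; (L3) $\sqrt{}$ is not one of its vertices. An entry/body-labeling $\hat{\mathcal{C}}$ of $\mathcal{C}$ assigns to each transition a marking label in $\mathbb{N}$; label $0$ marks body transitions $\to_{\mathrm{bo}}$; label $\alpha\ge1$ marks (loop-)entry transitions $\to_{[\alpha]}$ of level $\alpha$. For $v$ and $\alpha\ge1$ such that an entry transition of level $\alpha$ departs from $v$, $\mathcal{C}_{\hat{\mathcal{C}}}(v,\alpha)$ is the subchart with start vertex $v$ of all vertices and transitions on paths that start with an entry transition of level $\alpha$ from $v$, continue with body transitions only, and halt immediately if $v$ is revisited. $\hat{\mathcal{C}}$ is a LLEE-witness if (W1) there is no infinite path of body transitions from $v_s$; (W2) for every such $(v,\alpha)$: (a) $\mathcal{C}_{\hat{\mathcal{C}}}(v,\alpha)$ is a loop chart; (b) from no vertex $w\neq v$ of it there departs an entry transition of level $\beta\ge\alpha$. **Descends-in-loop.** $v\curvearrowright w$ if for some $\alpha\ge1$ there is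 a path from $v$ to $w$ consisting of one entry transition of level $\alpha$ followed by zero or more body transitions, with no transition on the path having target $v$. **Extraction functions.** (Sums are formed with respect to an arbitrary fixed enumeration of the transitions from each vertex.) The relative extraction function $t_{\hat{\mathcal{C}}}$ maps pairs $\langle w,v\rangle$ with $v\curvearrowright w$, $v,w\in V\setminus\{\sqrt{}\}$, to $StExp(A)$: $$t_{\hat{\mathcal{C}}}(w,v):=\Bigl(\bigl(\textstyle\sum_{i=1}^m a_i\bigr)+\bigl(\sum_{j=1}^n b_j\cdot t_{\hat{\mathcal{C}}}(w_j,w)\bigr)\Bigr)^{\circledast}\Bigl(\bigl(\sum_{i=1}^p c_i\bigr)+\bigl(\sum_{j=1}^q d_j\cdot t_{\hat{\mathcal{C}}}(u_j,v)\bigr)\Bigr)$$ where the entry transitions from $w$ are $\{w\xrightarrow{a_i}_{[\alpha_i]}w\}_{i\le m}\cup\{w\xrightarrow{b_j}_{[\beta_j]}w_j\mid w_j\ne w\}_{j\le n}$ and the body transitions from $w$ are $\{w\xrightarrow{c_i}_{\mathrm{bo}}v\}_{i\le p}\cup\{w\xrightarrow{d_j}_{\mathrm{bo}}u_j\mid u_j\neq v\}_{j\le q}$. The extraction function $s_{\hat{\mathcal{C}}}:V\setminus\{\sqrt{}\}\to StExp(A)$ is $$s_{\hat{\mathcal{C}}}(w):=\Bigl(\bigl(\textstyle\sum_{i=1}^m a_i\bigr)+\bigl(\sum_{j=1}^n b_j\cdot t_{\hat{\mathcal{C}}}(w_j,w)\bigr)\Bigr)^{\circledast}\Bigl(\bigl(\sum_{i=1}^p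 c_i\bigr)+\bigl(\sum_{j=1}^q d_j\cdot s_{\hat{\mathcal{C}}}(u_j)\bigr)\Bigr)$$ where the entry transitions from $w$ are as before and the body transitions from $w$ are $\{w\xrightarrow{c_i}_{\mathrm{bo}}\sqrt{}\}_{i\le p}\cup\{w\xrightarrow{d_j}_{\mathrm{bo}}u_j\mid u_j\ne\sqrt{}\}_{j\le q}$. Both are well-defined recursions: $t_{\hat{\mathcal{C}}}(w,v)$ by lexicographic induction on (maximal level of an entry transition from $v$, maximal length of a body transition path from $w$), and $s_{\hat{\mathcal{C}}}(w)$ by induction on the maximal length of a body transition path from $w$. *)

theory Defs
  imports Main
begin

text \<open>The set of actions is the type \<open>'a\<close>.\<close>

datatype 'a stexp =
    Zero
  | Act 'a
  | Plus "'a stexp" "'a stexp"  (infixl "\<^bold>+" 65)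
  | Times "'a stexp" "'a stexp"  (infixl "\<^bold>\<cdot>" 70)
  | Star "'a stexp" "'a stexp"  (infixl "\<^bold>*" 75)

text \<open>\<open>Star x y\<close> is the binary iteration of \<open>x\<close> exiting to \<open>y\<close>.
  Sums associate to the left.\<close>

fun stsum :: "'a stexp list \<Rightarrow> 'a stexp" where
  "stsum [] = Zero"
| "stsum (e # es) = foldl Plus e es"

inductive bbp :: "'a stexp \<Rightarrow> 'a stexp \<Rightarrow> bool"  (infix "=\<^sub>B\<^sub>B\<^sub>P" 50) where
  refl: "x =\<^sub>B\<^sub>B\<^sub>P x"
| sym: "x =\<^sub>B\<^sub>B\<^sub>P y \<Longrightarrow> y =\<^sub>B\<^sub>B\<^sub>P x"
| trans: "x =\<^sub>B\<^sub>B\<^sub>P y \<Longrightarrow> y =\<^sub>B\<^sub>B\<^sub>P z \<Longrightarrow> x =\<^sub>B\<^sub>B\<^sub>P z"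
| cong_plus: "x =\<^sub>B\<^sub>B\<^sub>P x' \<Longrightarrow> y =\<^sub>B\<^sub>B\<^sub>P y' \<Longrightarrow> x \<^bold>+ y =\<^sub>B\<^sub>B\<^sub>P x' \<^bold>+ y'"
| cong_times: "x =\<^sub>B\<^sub>B\<^sub>P x' \<Longrightarrow> y =\<^sub>B\<^sub>B\<^sub>P y' \<Longrightarrow> x \<^bold>\<cdot> y =\<^sub>B\<^sub>B\<^sub>P x' \<^bold>\<cdot> y'"
| cong_star: "x =\<^sub>B\<^sub>B\<^sub>P x' \<Longrightarrow> y =\<^sub>B\<^sub>B\<^sub>P y' \<Longrightarrow> x \<^bold>* y =\<^sub>B\<^sub>B\<^sub>P x' \<^bold>* y'"
| B1: "x \<^bold>+ y =\<^sub>B\<^sub>B\<^sub>P y \<^bold>+ x"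
| B2: "(x \<^bold>+ y) \<^bold>+ z =\<^sub>B\<^sub>B\<^sub>P x \<^bold>+ (y \<^bold>+ z)"
| B3: "x \<^bold>+ x =\<^sub>B\<^sub>B\<^sub>P x"
| B4: "(x \<^bold>+ y) \<^bold>\<cdot> z =\<^sub>B\<^sub>B\<^sub>P x \<^bold>\<cdot> z \<^bold>+ y \<^bold>\<cdot> z"
| B5: "(x \<^bold>\<cdot> y) \<^bold>\<cdot> z =\<^sub>B\<^sub>B\<^sub>P x \<^bold>\<cdot> (y \<^bold>\<cdot> z)"
| B6: "x \<^bold>+ Zero =\<^sub>B\<^sub>B\<^sub>P x"
| B7: "Zero \<^bold>\<cdot> x =\<^sub>B\<^sub>B\<^sub>P Zero"
| BKS1: "x \<^bold>\<cdot> (x \<^bold>* y) \<^bold>+ y =\<^sub>B\<^sub>B\<^sub>P x \<^bold>* y"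
| BKS2: "(x \<^bold>* y) \<^bold>\<cdot> z =\<^sub>B\<^sub>B\<^sub>P x \<^bold>* (y \<^bold>\<cdot> z)"
| RSP: "x =\<^sub>B\<^sub>B\<^sub>P (y \<^bold>\<cdot> x) \<^bold>+ z \<Longrightarrow> x =\<^sub>B\<^sub>B\<^sub>P y \<^bold>* z"

type_synonym ('v, 'a) transition = "'v \<times> 'a \<times> 'v"

abbreviation src :: "('v, 'a) transition \<Rightarrow> 'v" where "src \<tau> \<equiv> fst \<tau>"
abbreviation act :: "('v, 'a) transition \<Rightarrow> 'a" where "act \<tau> \<equiv> fst (snd \<tau>)"
abbreviation tgt :: "('v, 'a) transition \<Rightarrow> 'v" where "tgt \<tau> \<equiv> snd (snd \<tau>)"

text \<open>\<open>tick\<close> is the termination symbol; it need not belong to \<open>verts\<close>.\<close>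

record ('v, 'a) chart =
  verts :: "'v set"
  tick :: 'v
  start :: 'v
  transs :: "('v, 'a) transition set"

fun path :: "('v, 'a) transition set \<Rightarrow> 'v \<Rightarrow> ('v, 'a) transition list \<Rightarrow> 'v \<Rightarrow> bool" where
  "path T v [] w \<longleftrightarrow> v = w"
| "path T v (\<tau> # p) w \<longleftrightarrow> \<tau> \<in> T \<and> src \<tau> = v \<and> path T (tgt \<tau>) p w"

definition inf_path :: "('v, 'a) transition set \<Rightarrow> 'v \<Rightarrow> (nat \<Rightarrow> ('v, 'a) transition) \<Rightarrow> bool" where
  "inf_path T v f \<longleftrightarrow>
     src (f 0) = v \<and> (\<forall>i. f i \<in> T \<and> tgt (f i) = src (f (Suc i)))"

definition is_chart :: "('v, 'a) chart \<Rightarrow> bool" where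
  "is_chart C \<longleftrightarrow>
     finite (verts C) \<and>
     start C \<in> verts C - {tick C} \<and>
     transs C \<subseteq> verts C \<times> UNIV \<times> verts C \<and>
     finite (transs C) \<and>
     (\<forall>\<tau> \<in> transs C. src \<tau> \<noteq> tick C) \<and>
     (\<forall>v \<in> verts C. \<exists>p. path (transs C) (start C) p v)"

text \<open>The transitions from \<open>v\<close> are listed as \<open>as\<close> (actions of those to \<open>tick\<close>) and
  \<open>bws\<close> (action and target of the others). The condition is imposed for every such listing,
  with any order and repetitions. Only the values of \<open>s\<close> on \<open>verts C - {tick C}\<close> matter.\<close>

definition provable_solution :: "('v, 'a) chart \<Rightarrow> ('v \<Rightarrow> 'a stexp) \<Rightarrow> bool" where
  "provable_solution C s \<longleftrightarrow>
     (\<forall>v \<in> verts C - {tick C}. \<forall>as bws.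
        {\<tau> \<in> transs C. src \<tau> = v} =
          {(v, a, tick C) | a. a \<in> set as} \<union> {(v, b, w) | b w. (b, w) \<in> set bws} \<and>
        (\<forall>(b, w) \<in> set bws. w \<noteq> tick C) \<longrightarrow>
        s v =\<^sub>B\<^sub>B\<^sub>P stsum (map Act as) \<^bold>+ stsum (map (\<lambda>(b, w). Act b \<^bold>\<cdot> s w) bws))"

definition loop_chart :: "('v, 'a) chart \<Rightarrow> bool" where
  "loop_chart C \<longleftrightarrow>
     is_chart C \<and>
     (\<exists>f. inf_path (transs C) (start C) f) \<and>
     (\<forall>f. inf_path (transs C) (start C) f \<longrightarrow> (\<exists>n. tgt (f n) = start C)) \<and>
     tick C \<notin> verts C"

text \<open>An entry/body-labeling is a function \<open>l\<close> from transitions to marking labels, relevant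
  only on \<open>transs C\<close>.\<close>

type_synonym ('v, 'a) labeling = "('v, 'a) transition \<Rightarrow> nat"

definition body :: "('v, 'a) chart \<Rightarrow> ('v, 'a) labeling \<Rightarrow> ('v, 'a) transition set" where
  "body C l = {\<tau> \<in> transs C. l \<tau> = 0}"

definition entry :: "('v, 'a) chart \<Rightarrow> ('v, 'a) labeling \<Rightarrow> nat \<Rightarrow> 'v \<Rightarrow> ('v, 'a) transition set" where
  "entry C l \<alpha> v = {\<tau> \<in> transs C. l \<tau> = \<alpha> \<and> src \<tau> = v}"

definition entry_path ::
    "('v, 'a) chart \<Rightarrow> ('v, 'a) labeling \<Rightarrow> nat \<Rightarrow> 'v \<Rightarrow> ('v, 'a) transition list \<Rightarrow> 'v \<Rightarrow> bool" where
  "entry_path C l \<alpha> v p w \<longleftrightarrow>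
     (\<exists>\<tau> q. p = \<tau> # q \<and> \<tau> \<in> entry C l \<alpha> v \<and> path (body C l) (tgt \<tau>) q w)"

text \<open>The paths generating the subchart halt when \<open>v\<close> is revisited: only their last
  transition may have target \<open>v\<close>.\<close>

definition loop_subchart :: "('v, 'a) chart \<Rightarrow> ('v, 'a) labeling \<Rightarrow> 'v \<Rightarrow> nat \<Rightarrow> ('v, 'a) chart" where
  "loop_subchart C l v \<alpha> =
     (let T = \<Union> {set p | p. \<exists>w. entry_path C l \<alpha> v p w \<and> (\<forall>\<tau> \<in> set (butlast p). tgt \<tau> \<noteq> v)}
      in \<lparr>verts = src ` T \<union> tgt ` T, tick = tick C, start = v, transs = T\<rparr>)"

definition LLEE_witness :: "('v, 'a) chart \<Rightarrow> ('v, 'a) labeling \<Rightarrow> bool" where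
  "LLEE_witness C l \<longleftrightarrow>
     (\<nexists>f. inf_path (body C l) (start C) f) \<and>
     (\<forall>v \<alpha>. \<alpha> \<ge> 1 \<and> entry C l \<alpha> v \<noteq> {} \<longrightarrow>
        loop_chart (loop_subchart C l v \<alpha>) \<and>
        (\<forall>w \<in> verts (loop_subchart C l v \<alpha>) - {v}. \<forall>\<beta> \<ge> \<alpha>. entry C l \<beta> w = {}))"

text \<open>\<open>descends C l v w\<close>: \<open>v\<close> descends in a loop to \<open>w\<close>.\<close>

definition descends :: "('v, 'a) chart \<Rightarrow> ('v, 'a) labeling \<Rightarrow> 'v \<Rightarrow> 'v \<Rightarrow> bool" where
  "descends C l v w \<longleftrightarrow>
     (\<exists>\<alpha> \<ge> 1. \<exists>p. entry_path C l \<alpha> v p w \<and> (\<forall>\<tau> \<in> set p. tgt \<tau> \<noteq> v))"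

definition transition_enum ::
    "('v, 'a) chart \<Rightarrow> ('v \<Rightarrow> ('v, 'a) transition list) \<Rightarrow> bool" where
  "transition_enum C en \<longleftrightarrow>
     (\<forall>v \<in> verts C. distinct (en v) \<and> set (en v) = {\<tau> \<in> transs C. src \<tau> = v})"

text \<open>The two extraction functions, with summands ordered by the enumeration \<open>en\<close>. The
  recursions are guaranteed to terminate for LLEE-witnesses of charts, but not in general, so
  they are introduced as partial functions: the equations are available as \<open>psimps\<close>, on the domains \<open>rel_extraction_dom\<close> and
  \<open>extraction_dom\<close>.\<close>

function (domintros) rel_extraction ::
    "('v, 'a) chart \<Rightarrow> ('v, 'a) labeling \<Rightarrow> ('v \<Rightarrow> ('v, 'a) transition list) \<Rightarrow> 'v \<Rightarrow> 'v \<Rightarrow> 'a stexp" where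
  "rel_extraction C l en w v =
     (if v \<in> verts C - {tick C} \<and> w \<in> verts C - {tick C} \<and> descends C l v w
      then
        (stsum (map (\<lambda>\<tau>. Act (act \<tau>)) (filter (\<lambda>\<tau>. l \<tau> \<ge> 1 \<and> tgt \<tau> = w) (en w))) \<^bold>+
         stsum (map (\<lambda>\<tau>. Act (act \<tau>) \<^bold>\<cdot> rel_extraction C l en (tgt \<tau>) w)
                  (filter (\<lambda>\<tau>. l \<tau> \<ge> 1 \<and> tgt \<tau> \<noteq> w) (en w))))
        \<^bold>*
        (stsum (map (\<lambda>\<tau>. Act (act \<tau>)) (filter (\<lambda>\<tau>. l \<tau> = 0 \<and> tgt \<tau> = v) (en w))) \<^bold>+
         stsum (map (\<lambda>\<tau>. Act (act \<tau>) \<^bold>\<cdot> rel_extraction C l en (tgt \<tau>) v)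
                  (filter (\<lambda>\<tau>. l \<tau> = 0 \<and> tgt \<tau> \<noteq> v) (en w))))
      else undefined)"
  by pat_completeness auto

function (domintros) extraction ::
    "('v, 'a) chart \<Rightarrow> ('v, 'a) labeling \<Rightarrow> ('v \<Rightarrow> ('v, 'a) transition list) \<Rightarrow> 'v \<Rightarrow> 'a stexp" where
  "extraction C l en w =
     (if w \<in> verts C - {tick C}
      then
        (stsum (map (\<lambda>\<tau>. Act (act \<tau>)) (filter (\<lambda>\<tau>. l \<tau> \<ge> 1 \<and> tgt \<tau> = w) (en w))) \<^bold>+
         stsum (map (\<lambda>\<tau>. Act (act \<tau>) \<^bold>\<cdot> rel_extraction C l en (tgt \<tau>) w)
                  (filter (\<lambda>\<tau>. l \<tau> \<ge> 1 \<and> tgt \<tau> \<noteq> w) (en w))))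
        \<^bold>*
        (stsum (map (\<lambda>\<tau>. Act (act \<tau>)) (filter (\<lambda>\<tau>. l \<tau> = 0 \<and> tgt \<tau> = tick C) (en w))) \<^bold>+
         stsum (map (\<lambda>\<tau>. Act (act \<tau>) \<^bold>\<cdot> extraction C l en (tgt \<tau>))
                  (filter (\<lambda>\<tau>. l \<tau> = 0 \<and> tgt \<tau> \<noteq> tick C) (en w))))
      else undefined)"
  by pat_completeness auto

end

theory Submission
  imports Defs
begin

text \<open>
  If \<open>v\<close> descends in a loop to \<open>w\<close>, then \<open>s(w) = t(w,v) \<cdot> s(v)\<close>: by (BKS2) the factor \<open>s(v)\<close> moves
  into the exit part of \<open>t(w,v)\<close>, where body transitions to \<open>v\<close> become summands \<open>c \<cdot> s(v)\<close> and the
  others are treated by induction on body transitions. Hence, after unfolding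
  \<open>s(w) = E \<^bold>* B\<close> to \<open>E \<cdot> s(w) + B\<close> with (BKS1), each summand \<open>b \<cdot> t(w',w) \<cdot> s(w)\<close> of \<open>E \<cdot> s(w)\<close>
  equals \<open>b \<cdot> s(w')\<close>. Body transitions are well-founded on the whole chart although (W1) speaks
  only about the start vertex: a vertex behind an entry transition lies in a loop chart, whose
  infinite body paths have to return to the source of that entry transition.
\<close>

subsection \<open>Sums modulo \<open>BBP\<close>\<close>

declare bbp.refl [simp] bbp.trans [trans]

text \<open>The semilattice order that (B1), (B2), (B3) and (B6) induce on expressions, with sums as
  joins and \<open>Zero\<close> at the bottom. Equations between sums then follow from two
  inequalities, without permuting summands.\<close>

definition bbp_le :: "'a stexp \<Rightarrow> 'a stexp \<Rightarrow> bool" (infix "\<sqsubseteq>\<^sub>B" 50) where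
  "x \<sqsubseteq>\<^sub>B y \<longleftrightarrow> x \<^bold>+ y =\<^sub>B\<^sub>B\<^sub>P y"

lemma bbp_imp_le: "x =\<^sub>B\<^sub>B\<^sub>P y \<Longrightarrow> x \<sqsubseteq>\<^sub>B y"
  unfolding bbp_le_def by (rule bbp.trans[OF bbp.cong_plus[OF _ bbp.refl] bbp.B3])

lemma bbp_le_antisym: "x \<sqsubseteq>\<^sub>B y \<Longrightarrow> y \<sqsubseteq>\<^sub>B x \<Longrightarrow> x =\<^sub>B\<^sub>B\<^sub>P y"
  unfolding bbp_le_def by (rule bbp.trans[OF bbp.sym bbp.trans[OF bbp.B1]])

lemma bbp_le_trans [trans]:
  assumes "x \<sqsubseteq>\<^sub>B y" "y \<sqsubseteq>\<^sub>B z"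
  shows "x \<sqsubseteq>\<^sub>B z"
proof -
  have "x \<^bold>+ z =\<^sub>B\<^sub>B\<^sub>P x \<^bold>+ (y \<^bold>+ z)"
    using assms(2) unfolding bbp_le_def by (intro bbp.cong_plus bbp.refl) (rule bbp.sym)
  also have "x \<^bold>+ (y \<^bold>+ z) =\<^sub>B\<^sub>B\<^sub>P (x \<^bold>+ y) \<^bold>+ z" by (rule bbp.sym[OF bbp.B2])
  also have "(x \<^bold>+ y) \<^bold>+ z =\<^sub>B\<^sub>B\<^sub>P y \<^bold>+ z"
    using assms(1) unfolding bbp_le_def by (intro bbp.cong_plus) auto
  also have "y \<^bold>+ z =\<^sub>B\<^sub>B\<^sub>P z" using assms(2) unfolding bbp_le_def .
  finally show ?thesis unfolding bbp_le_def .
qed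

lemma bbp_le_plus1: "x \<sqsubseteq>\<^sub>B x \<^bold>+ y"
  unfolding bbp_le_def by (rule bbp.trans[OF bbp.sym[OF bbp.B2] bbp.cong_plus[OF bbp.B3 bbp.refl]])

lemma bbp_le_plus2: "y \<sqsubseteq>\<^sub>B x \<^bold>+ y"
  by (rule bbp_le_trans[OF bbp_le_plus1 bbp_imp_le[OF bbp.B1]])

lemma bbp_le_plusI: "x \<sqsubseteq>\<^sub>B z \<Longrightarrow> y \<sqsubseteq>\<^sub>B z \<Longrightarrow> x \<^bold>+ y \<sqsubseteq>\<^sub>B z"
  unfolding bbp_le_def by (rule bbp.trans[OF bbp.B2 bbp.trans[OF bbp.cong_plus[OF bbp.refl]]])

lemma bbp_le_Zero: "Zero \<sqsubseteq>\<^sub>B z"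
  unfolding bbp_le_def by (rule bbp.trans[OF bbp.B1 bbp.B6])

text \<open>Sums associate to the left and so grow at the right end, which is why the inductions
  below use \<open>rev_induct\<close>. The case split reflects that a singleton sum is the summand
  itself, not \<open>Zero\<close> plus it.\<close>

lemma stsum_snoc: "stsum (xs @ [x]) = (if xs = [] then x else stsum xs \<^bold>+ x)"
  by (cases xs) auto

lemma stsum_upper: "x \<in> set xs \<Longrightarrow> x \<sqsubseteq>\<^sub>B stsum xs"
proof (induction xs rule: rev_induct)
  case (snoc y ys)
  show ?case
  proof (cases "x \<in> set ys")
    case True
    with snoc.IH have "x \<sqsubseteq>\<^sub>B stsum ys" by simp
    also have "stsum ys \<sqsubseteq>\<^sub>B stsum (ys @ [y])"
      using True by (auto simp: stsum_snoc bbp_le_plus1)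
    finally show ?thesis .
  next
    case False
    with snoc.prems show ?thesis by (auto simp: stsum_snoc bbp_imp_le bbp_le_plus2)
  qed
qed auto

lemma stsum_least: "(\<And>x. x \<in> set xs \<Longrightarrow> x \<sqsubseteq>\<^sub>B z) \<Longrightarrow> stsum xs \<sqsubseteq>\<^sub>B z"
  by (induction xs rule: rev_induct)
    (auto simp: stsum_snoc bbp_le_Zero intro: bbp_le_plusI)

text \<open>\<open>stsum\<close> is a least upper bound, so it depends only on the set of summands
  modulo provable equality. This absorbs the arbitrary order and the repetitions in enumerations and
  listings.\<close>

lemma stsum_eqI:
  assumes "\<And>x. x \<in> set xs \<Longrightarrow> \<exists>y\<in>set ys. x =\<^sub>B\<^sub>B\<^sub>P y"
    and "\<And>y. y \<in> set ys \<Longrightarrow> \<exists>x\<in>set xs. x =\<^sub>B\<^sub>B\<^sub>P y"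
  shows "stsum xs =\<^sub>B\<^sub>B\<^sub>P stsum ys"
  by (intro bbp_le_antisym stsum_least)
    (blast dest: assms intro: bbp.sym bbp_le_trans[OF bbp_imp_le stsum_upper])+

lemma stsum_append: "stsum (xs @ ys) =\<^sub>B\<^sub>B\<^sub>P stsum xs \<^bold>+ stsum ys"
  by (intro bbp_le_antisym stsum_least bbp_le_plusI)
    (auto intro: stsum_upper bbp_le_trans[OF stsum_upper bbp_le_plus1]
      bbp_le_trans[OF stsum_upper bbp_le_plus2])

lemma stsum_times: "stsum xs \<^bold>\<cdot> z =\<^sub>B\<^sub>B\<^sub>P stsum (map (\<lambda>x. x \<^bold>\<cdot> z) xs)"
proof (induction xs rule: rev_induct)
  case Nil
  show ?case by (simp add: bbp.B7)
next
  case (snoc x xs)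
  then show ?case
    by (auto simp: stsum_snoc simp del: stsum.simps
        intro: bbp.trans[OF bbp.B4 bbp.cong_plus])
qed

lemma stsum_plus_times:
  "(stsum xs \<^bold>+ stsum ys) \<^bold>\<cdot> z =\<^sub>B\<^sub>B\<^sub>P stsum (map (\<lambda>x. x \<^bold>\<cdot> z) (xs @ ys))"
  by (rule bbp.trans[OF bbp.cong_times[OF bbp.sym[OF stsum_append] bbp.refl] stsum_times])

lemma bbp_times_prefix: "x \<^bold>\<cdot> z =\<^sub>B\<^sub>B\<^sub>P y \<Longrightarrow> (b \<^bold>\<cdot> x) \<^bold>\<cdot> z =\<^sub>B\<^sub>B\<^sub>P b \<^bold>\<cdot> y"
  by (rule bbp.trans[OF bbp.B5 bbp.cong_times[OF bbp.refl]])

subsection \<open>Paths and LLEE-witnesses\<close>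

lemma path_append: "path T v (p @ q) w \<longleftrightarrow> (\<exists>u. path T v p u \<and> path T u q w)"
  by (induction p arbitrary: v) auto

lemma inf_path_prefix: "inf_path T v f \<Longrightarrow> path T v (map f [0..<n]) (src (f n))"
  by (induction n) (auto simp: inf_path_def path_append)

lemma inf_path_suffix: "inf_path T v f \<Longrightarrow> inf_path T (src (f n)) (\<lambda>i. f (i + n))"
  by (auto simp: inf_path_def)

lemma inf_path_Cons:
  "\<tau> \<in> T \<Longrightarrow> inf_path T (tgt \<tau>) f \<Longrightarrow> inf_path T (src \<tau>) (case_nat \<tau> f)"
  by (auto simp: inf_path_def split: nat.split)

lemma start_loop_subchart [simp]: "start (loop_subchart C l v \<alpha>) = v"
  and tick_loop_subchart [simp]: "tick (loop_subchart C l v \<alpha>) = tick C"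
  by (simp_all add: loop_subchart_def Let_def)

text \<open>Applied to successive prefixes, this puts every transition of a path into the subchart.
  \<open>butlast\<close> leaves room for a final step back to \<open>v\<close>.\<close>

lemma last_in_loop_subchart:
  assumes "entry_path C l \<alpha> v p w" "\<And>\<tau>. \<tau> \<in> set (butlast p) \<Longrightarrow> tgt \<tau> \<noteq> v"
  shows "last p \<in> transs (loop_subchart C l v \<alpha>)"
proof -
  have "p \<noteq> []" using assms(1) by (auto simp: entry_path_def)
  hence "last p \<in> set p" by simp
  with assms show ?thesis unfolding loop_subchart_def Let_def by simp blast
qed

lemma tgt_last_path: "path T v p w \<Longrightarrow> p \<noteq> [] \<Longrightarrow> tgt (last p) = w"
  by (induction p arbitrary: v) auto

lemma tgt_last_entry_path: "entry_path C l \<alpha> v p w \<Longrightarrow> tgt (last p) = w"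
  by (auto simp: entry_path_def dest: tgt_last_path)

text \<open>Turns a descent into membership in a loop subchart, the form in which (W2) can be
  applied.\<close>

lemma descendsE:
  assumes "descends C l v w"
  obtains \<alpha> where "\<alpha> \<ge> 1" "entry C l \<alpha> v \<noteq> {}" "w \<in> verts (loop_subchart C l v \<alpha>) - {v}"
proof -
  from assms obtain \<alpha> p where p: "\<alpha> \<ge> 1" "entry_path C l \<alpha> v p w" "\<forall>\<tau>\<in>set p. tgt \<tau> \<noteq> v"
    by (auto simp: descends_def)
  have "last p \<in> transs (loop_subchart C l v \<alpha>)"
    using p by (intro last_in_loop_subchart) (auto dest: in_set_butlastD)
  hence "w \<in> verts (loop_subchart C l v \<alpha>)"
    using tgt_last_entry_path[OF p(2)] by (force simp: loop_subchart_def Let_def)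
  moreover have "p \<noteq> []" and "entry C l \<alpha> v \<noteq> {}" using p(2) by (auto simp: entry_path_def)
  moreover have "w \<noteq> v" using p(3) \<open>p \<noteq> []\<close> tgt_last_entry_path[OF p(2)] by auto
  ultimately show ?thesis using that p(1) by auto
qed

lemma descends_entry:
  "\<tau> \<in> transs C \<Longrightarrow> l \<tau> \<ge> 1 \<Longrightarrow> tgt \<tau> \<noteq> src \<tau> \<Longrightarrow> descends C l (src \<tau>) (tgt \<tau>)"
  unfolding descends_def entry_path_def entry_def
  by (intro exI[of _ "l \<tau>"] conjI exI[of _ "[\<tau>]"]) auto

text \<open>Body steps that avoid \<open>v\<close> stay inside the loop at \<open>v\<close>, so the
  recursive calls in the exit part of the relative extraction keep satisfying its guard.\<close>

lemma descends_body:
  assumes "descends C l v (src \<tau>)" "\<tau> \<in> body C l" "tgt \<tau> \<noteq> v"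
  shows "descends C l v (tgt \<tau>)"
proof -
  from assms(1) obtain \<alpha> p
    where "\<alpha> \<ge> 1" "entry_path C l \<alpha> v p (src \<tau>)" "\<forall>\<sigma>\<in>set p. tgt \<sigma> \<noteq> v"
    by (auto simp: descends_def)
  hence "entry_path C l \<alpha> v (p @ [\<tau>]) (tgt \<tau>)" "\<forall>\<sigma>\<in>set (p @ [\<tau>]). tgt \<sigma> \<noteq> v"
    using assms(2,3) by (auto simp: entry_path_def path_append)
  with \<open>\<alpha> \<ge> 1\<close> show ?thesis unfolding descends_def by blast
qed

section \<open>Well-foundedness of body transitions\<close>

locale llee_chart =
  fixes C :: "('v, 'a) chart"
    and l :: "('v, 'a) labeling"
    and en :: "'v \<Rightarrow> ('v, 'a) transition list"
  assumes chart: "is_chart C"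
    and witness: "LLEE_witness C l"
    and enum: "transition_enum C en"
begin

lemma trans_verts: "\<tau> \<in> transs C \<Longrightarrow> src \<tau> \<in> verts C - {tick C} \<and> tgt \<tau> \<in> verts C"
  using chart by (fastforce simp: is_chart_def)

lemma set_en: "v \<in> verts C \<Longrightarrow> set (en v) = {\<tau> \<in> transs C. src \<tau> = v}"
  using enum by (auto simp: transition_enum_def)

lemma loop_chart_subchart: "\<alpha> \<ge> 1 \<Longrightarrow> entry C l \<alpha> v \<noteq> {} \<Longrightarrow> loop_chart (loop_subchart C l v \<alpha>)"
  using witness by (auto simp: LLEE_witness_def)

text \<open>Induction along the path that reaches \<open>v\<close>. If its last transition is a body
  transition, prepending it to \<open>f\<close> contradicts the induction hypothesis; if it is an
  entry transition, prepending it gives an infinite path that violates (L2).\<close>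

lemma no_inf_body_path: "path (transs C) (start C) p v \<Longrightarrow> \<not> inf_path (body C l) v f"
proof (induction p arbitrary: v f rule: rev_induct)
  case Nil
  then show ?case using witness by (auto simp: LLEE_witness_def)
next
  case (snoc \<tau> p)
  hence \<tau>: "\<tau> \<in> transs C" "tgt \<tau> = v" and p: "path (transs C) (start C) p (src \<tau>)"
    by (auto simp: path_append)
  show ?case
  proof
    assume f: "inf_path (body C l) v f"
    show False
    proof (cases "l \<tau> = 0")
      case True
      with \<tau> f have "inf_path (body C l) (src \<tau>) (case_nat \<tau> f)"
        by (intro inf_path_Cons) (auto simp: body_def)
      with snoc.IH[OF p] show False by blast
    next
      case False
      let ?S = "loop_subchart C l (src \<tau>) (l \<tau>)" and ?g = "case_nat \<tau> f"
      have \<tau>e: "\<tau> \<in> entry C l (l \<tau>) (src \<tau>)" using \<tau> by (simp add: entry_def)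
      \<comment> \<open>A return to the source of \<open>\<tau>\<close> would leave a suffix of
        \<open>f\<close> as an infinite body path from there, which the induction hypothesis
        excludes.\<close>
      have avoid: "tgt (?g n) \<noteq> src \<tau>" for n
      proof -
        have "tgt (?g n) = src (f n)"
          using f \<tau>(2) by (cases n) (auto simp: inf_path_def)
        moreover have "src (f n) \<noteq> src \<tau>"
          using snoc.IH[OF p] inf_path_suffix[OF f, of n] by metis
        ultimately show ?thesis by simp
      qed
      \<comment> \<open>The first \<open>Suc n\<close> transitions of \<open>?g\<close> form an
        entry path that does not return, and \<open>?g n\<close> is its last transition.\<close>
      have in_sub: "?g n \<in> transs ?S" for n
      proof -
        let ?p = "\<tau> # map f [0..<n]"
        have p_eq: "?p = map ?g [0..<Suc n]"
          by (simp add: upt_rec[of 0 "Suc n"] map_Suc_upt[symmetric] del: upt_Suc)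
        have "entry_path C l (l \<tau>) (src \<tau>) ?p (src (f n))"
          using \<tau>e inf_path_prefix[OF f] \<tau>(2) by (auto simp: entry_path_def)
        moreover have "tgt \<sigma> \<noteq> src \<tau>" if "\<sigma> \<in> set (butlast ?p)" for \<sigma>
          using in_set_butlastD[OF that] avoid unfolding p_eq by auto
        ultimately have "last ?p \<in> transs ?S" by (rule last_in_loop_subchart)
        thus ?thesis unfolding p_eq by simp
      qed
      have "inf_path (transs ?S) (start ?S) ?g"
        using in_sub f \<tau>(2) by (auto simp: inf_path_def split: nat.split)
      moreover have "loop_chart ?S"
        using \<tau>e False by (intro loop_chart_subchart) auto
      ultimately show False using avoid by (auto simp: loop_chart_def)
    qed
  qed
qed

lemma wf_body: "wf {(tgt \<tau>, src \<tau>) | \<tau>. \<tau> \<in> body C l}"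
  unfolding wf_iff_no_infinite_down_chain
proof
  assume "\<exists>g. \<forall>i. (g (Suc i), g i) \<in> {(tgt \<tau>, src \<tau>) | \<tau>. \<tau> \<in> body C l}"
  then obtain g where "\<And>i. (g (Suc i), g i) \<in> {(tgt \<tau>, src \<tau>) | \<tau>. \<tau> \<in> body C l}"
    by blast
  hence "\<forall>i. \<exists>\<tau>. \<tau> \<in> body C l \<and> tgt \<tau> = g (Suc i) \<and> src \<tau> = g i"
    by (smt (verit) Pair_inject mem_Collect_eq)
  then obtain f where f: "\<And>i. f i \<in> body C l \<and> tgt (f i) = g (Suc i) \<and> src (f i) = g i"
    by metis
  hence "inf_path (body C l) (g 0) f" by (auto simp: inf_path_def)
  \<comment> \<open>As the source of a body transition, \<open>g 0\<close> is a vertex and hence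
    reachable from the start.\<close>
  moreover have "g 0 \<in> verts C" using f[of 0] trans_verts[of "f 0"] by (simp add: body_def)
  ultimately show False using no_inf_body_path chart by (auto simp: is_chart_def)
qed

text \<open>Plays the role of induction on the maximal length of a body path from
  \<open>w\<close>.\<close>

lemma body_induct [case_names body]:
  assumes "\<And>w. (\<And>\<tau>. \<tau> \<in> body C l \<Longrightarrow> src \<tau> = w \<Longrightarrow> P (tgt \<tau>)) \<Longrightarrow> P w"
  shows "P w"
  using wf_body
proof (induction w rule: wf_induct_rule)
  case (less w)
  show ?case by (rule assms, rule less) auto
qed

section \<open>Descent, levels and termination of the extraction recursions\<close>

lemma descends_verts:
  assumes "descends C l v w"
  shows "v \<in> verts C - {tick C}" "w \<in> verts C - {tick C}"
proof -
  from assms obtain \<alpha> where \<alpha>: "\<alpha> \<ge> 1" "entry C l \<alpha> v \<noteq> {}"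
    "w \<in> verts (loop_subchart C l v \<alpha>) - {v}" by (rule descendsE)
  then show "v \<in> verts C - {tick C}" by (auto simp: entry_def dest: trans_verts)
  have "transs (loop_subchart C l v \<alpha>) \<subseteq> transs C"
  proof -
    have "path T u p x \<Longrightarrow> set p \<subseteq> T" for T :: "('v, 'a) transition set" and u p x
      by (induction p arbitrary: u) auto
    thus ?thesis
      by (fastforce simp: loop_subchart_def Let_def entry_path_def entry_def body_def)
  qed
  with \<alpha>(3) have "w \<in> verts C"
    by (auto simp: loop_subchart_def Let_def dest: trans_verts)
  \<comment> \<open>The subchart shares its \<open>tick\<close> with \<open>C\<close>, and (L3)
    keeps it out of loop charts.\<close>
  moreover have "w \<noteq> tick C"
    using \<alpha> loop_chart_subchart[of \<alpha> v] by (auto simp: loop_chart_def)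
  ultimately show "w \<in> verts C - {tick C}" by simp
qed

text \<open>Body labels are 0, so this is the maximal level of an entry transition from
  \<open>v\<close>; inserting 0 supplies a value when there is none.\<close>

definition level :: "'v \<Rightarrow> nat" where
  "level v = Max (insert 0 (l ` {\<tau> \<in> transs C. src \<tau> = v}))"

text \<open>By (W2)(b), every entry level at \<open>w\<close> lies below the level \<alpha> of the
  loop through which \<open>v\<close> descends to \<open>w\<close>, while \<open>v\<close> itself
  has an entry transition of level \<alpha>.\<close>

lemma level_less:
  assumes "descends C l v w"
  shows "level w < level v"
proof -
  from assms obtain \<alpha> where \<alpha>: "\<alpha> \<ge> 1" "entry C l \<alpha> v \<noteq> {}"
    "w \<in> verts (loop_subchart C l v \<alpha>) - {v}" by (rule descendsE)
  have fin: "finite (insert 0 (l ` {\<tau> \<in> transs C. src \<tau> = u}))" for u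
    using chart by (auto simp: is_chart_def)
  have "\<alpha> \<le> level v"
    using \<alpha>(2) fin unfolding level_def by (intro Max_ge) (auto simp: entry_def)
  moreover have "entry C l \<beta> w = {}" if "\<beta> \<ge> \<alpha>" for \<beta>
    using witness \<alpha> that unfolding LLEE_witness_def by blast
  hence "l \<tau> < \<alpha>" if "\<tau> \<in> transs C" "src \<tau> = w" for \<tau>
    using that by (fastforce simp: entry_def not_le[symmetric])
  hence "level w < \<alpha>"
    using \<alpha>(1) fin[of w] unfolding level_def by (auto simp: Max_less_iff)
  ultimately show ?thesis by simp
qed

text \<open>Lexicographic termination as nested inductions. Calls in the iterated part replace
  \<open>v\<close> by \<open>w\<close>, of smaller level; calls in the exit part keep
  \<open>v\<close> and follow a body transition. Outside the guard there are no calls, so no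
  assumption on \<open>w\<close> and \<open>v\<close> is needed.\<close>

lemma rel_extraction_dom: "rel_extraction_dom (C, l, en, w, v)"
proof (induction "level v" arbitrary: v w rule: less_induct)
  case less
  show ?case
  proof (induction w rule: body_induct)
    case (body w)
    show ?case
    proof (rule rel_extraction.domintros)
      fix u a x
      assume "descends C l v w"
      thus "rel_extraction_dom (C, l, en, x, w)"
        by (intro less level_less)
    next
      fix u a x
      assume "(u, a, x) \<in> set (en w)" "l (u, a, x) = 0" "w \<in> verts C"
      thus "rel_extraction_dom (C, l, en, x, v)"
        using body[of "(u, a, x)"] by (auto simp: set_en body_def)
    qed
  qed
qed

lemma extraction_dom: "extraction_dom (C, l, en, w)"
proof (induction w rule: body_induct)
  case (body w)
  show ?case
  proof (rule extraction.domintros)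
    fix u a x
    assume "(u, a, x) \<in> set (en w)" "l (u, a, x) = 0" "w \<in> verts C"
    thus "extraction_dom (C, l, en, x)"
      using body[of "(u, a, x)"] by (auto simp: set_en body_def)
  qed
qed

section \<open>The extraction function as a provable solution\<close>

abbreviation "s \<equiv> extraction C l en"
abbreviation "t \<equiv> rel_extraction C l en"

text \<open>The iterated expression common to \<open>s w\<close> and to all \<open>t w v\<close>;
  these differ only in their exit parts, and (BKS2) acts exactly there.\<close>

definition loop_part :: "'v \<Rightarrow> 'a stexp" where
  "loop_part w =
     stsum (map (\<lambda>\<tau>. Act (act \<tau>)) (filter (\<lambda>\<tau>. l \<tau> \<ge> 1 \<and> tgt \<tau> = w) (en w))) \<^bold>+
     stsum (map (\<lambda>\<tau>. Act (act \<tau>) \<^bold>\<cdot> t (tgt \<tau>) w) (filter (\<lambda>\<tau>. l \<tau> \<ge> 1 \<and> tgt \<tau> \<noteq> w) (en w)))"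

text \<open>Kept as one list, so that exit parts can be compared summand by summand with
  \<open>stsum_eqI\<close>.\<close>

definition exit_summands :: "'v \<Rightarrow> 'a stexp list" where
  "exit_summands w =
     map (\<lambda>\<tau>. Act (act \<tau>)) (filter (\<lambda>\<tau>. l \<tau> = 0 \<and> tgt \<tau> = tick C) (en w)) @
     map (\<lambda>\<tau>. Act (act \<tau>) \<^bold>\<cdot> s (tgt \<tau>)) (filter (\<lambda>\<tau>. l \<tau> = 0 \<and> tgt \<tau> \<noteq> tick C) (en w))"

lemma s_unfold:
  assumes "w \<in> verts C - {tick C}"
  shows "s w =\<^sub>B\<^sub>B\<^sub>P loop_part w \<^bold>* stsum (exit_summands w)"
  unfolding extraction.psimps[OF extraction_dom, of w] if_P[OF assms]
    loop_part_def exit_summands_def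
  by (intro bbp.cong_star bbp.refl bbp.sym[OF stsum_append])

lemma t_unfold:
  assumes "descends C l v w"
  shows "t w v = loop_part w \<^bold>*
        (stsum (map (\<lambda>\<tau>. Act (act \<tau>)) (filter (\<lambda>\<tau>. l \<tau> = 0 \<and> tgt \<tau> = v) (en w))) \<^bold>+
         stsum (map (\<lambda>\<tau>. Act (act \<tau>) \<^bold>\<cdot> t (tgt \<tau>) v)
                  (filter (\<lambda>\<tau>. l \<tau> = 0 \<and> tgt \<tau> \<noteq> v) (en w))))"
  using assms descends_verts[OF assms]
  unfolding rel_extraction.psimps[OF rel_extraction_dom, of w v] loop_part_def by simp

lemma t_times_s: "descends C l v w \<Longrightarrow> t w v \<^bold>\<cdot> s v =\<^sub>B\<^sub>B\<^sub>P s w"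
proof (induction w rule: body_induct)
  case (body w)
  note verts = descends_verts[OF body.prems]
  note en = set_en[of w]
  define cs where "cs = map (\<lambda>\<tau>. Act (act \<tau>)) (filter (\<lambda>\<tau>. l \<tau> = 0 \<and> tgt \<tau> = v) (en w))"
  define ds where "ds = map (\<lambda>\<tau>. Act (act \<tau>) \<^bold>\<cdot> t (tgt \<tau>) v)
    (filter (\<lambda>\<tau>. l \<tau> = 0 \<and> tgt \<tau> \<noteq> v) (en w))"
  have desc: "descends C l v (tgt \<tau>)" "(Act (act \<tau>) \<^bold>\<cdot> t (tgt \<tau>) v) \<^bold>\<cdot> s v =\<^sub>B\<^sub>B\<^sub>P Act (act \<tau>) \<^bold>\<cdot> s (tgt \<tau>)"
    if "\<tau> \<in> set (en w)" "l \<tau> = 0" "tgt \<tau> \<noteq> v" for \<tau>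
  proof -
    have \<tau>: "\<tau> \<in> body C l" "src \<tau> = w" using that verts by (auto simp: set_en body_def)
    show d: "descends C l v (tgt \<tau>)"
      using descends_body[OF _ \<tau>(1) that(3)] \<tau>(2) body.prems by simp
    show "(Act (act \<tau>) \<^bold>\<cdot> t (tgt \<tau>) v) \<^bold>\<cdot> s v =\<^sub>B\<^sub>B\<^sub>P Act (act \<tau>) \<^bold>\<cdot> s (tgt \<tau>)"
      by (intro bbp_times_prefix body.IH \<tau> d)
  qed
  \<comment> \<open>A body transition from inside the loop leads to \<open>v\<close> or to a vertex
    to which \<open>v\<close> descends, and neither is \<open>tick\<close>. Hence every exit summand
    of \<open>s w\<close> has the form \<open>Act b\<close> times some \<open>s u\<close>.\<close>
  have no_tick: "tgt \<tau> \<noteq> tick C" if "\<tau> \<in> set (en w)" "l \<tau> = 0" for \<tau>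
    using desc(1)[OF that] descends_verts verts by (cases "tgt \<tau> = v") auto
  have "t w v \<^bold>\<cdot> s v =\<^sub>B\<^sub>B\<^sub>P loop_part w \<^bold>* ((stsum cs \<^bold>+ stsum ds) \<^bold>\<cdot> s v)"
    unfolding t_unfold[OF body.prems] cs_def ds_def by (rule bbp.BKS2)
  also have "loop_part w \<^bold>* ((stsum cs \<^bold>+ stsum ds) \<^bold>\<cdot> s v) =\<^sub>B\<^sub>B\<^sub>P
      loop_part w \<^bold>* stsum (exit_summands w)"
  proof (intro bbp.cong_star bbp.refl bbp.trans[OF stsum_plus_times] stsum_eqI)
    fix x assume "x \<in> set (map (\<lambda>x. x \<^bold>\<cdot> s v) (cs @ ds))"
    then obtain \<tau> where \<tau>: "\<tau> \<in> set (en w)" "l \<tau> = 0" "x =\<^sub>B\<^sub>B\<^sub>P Act (act \<tau>) \<^bold>\<cdot> s (tgt \<tau>)"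
      using desc(2) by (auto simp: cs_def ds_def)
    with no_tick[OF \<tau>(1,2)] show "\<exists>y\<in>set (exit_summands w). x =\<^sub>B\<^sub>B\<^sub>P y"
      by (intro bexI[of _ "Act (act \<tau>) \<^bold>\<cdot> s (tgt \<tau>)"]) (auto simp: exit_summands_def)
  next
    fix y assume "y \<in> set (exit_summands w)"
    then obtain \<tau> where \<tau>: "\<tau> \<in> set (en w)" "l \<tau> = 0" "y = Act (act \<tau>) \<^bold>\<cdot> s (tgt \<tau>)"
      using no_tick by (auto simp: exit_summands_def)
    show "\<exists>x\<in>set (map (\<lambda>x. x \<^bold>\<cdot> s v) (cs @ ds)). x =\<^sub>B\<^sub>B\<^sub>P y"
    proof (cases "tgt \<tau> = v")
      case True
      with \<tau> have "y \<in> set (map (\<lambda>x. x \<^bold>\<cdot> s v) cs)" by (force simp: cs_def)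
      thus ?thesis by force
    next
      case False
      with \<tau> have "(Act (act \<tau>) \<^bold>\<cdot> t (tgt \<tau>) v) \<^bold>\<cdot> s v \<in> set (map (\<lambda>x. x \<^bold>\<cdot> s v) ds)"
        by (force simp: ds_def)
      with desc(2)[OF \<tau>(1,2) False] \<tau>(3) show ?thesis by force
    qed
  qed
  also have "loop_part w \<^bold>* stsum (exit_summands w) =\<^sub>B\<^sub>B\<^sub>P s w"
    using verts by (intro bbp.sym[OF s_unfold])
  finally show ?case .
qed

text \<open>No further induction: an entry transition to another vertex is itself a one-step descent
  from \<open>w\<close>, so \<open>t_times_s\<close> rewrites its summand. A self-loop summand
  already has the required form after distributing \<open>s w\<close>.\<close>

lemma loop_part_times_s:
  assumes "w \<in> verts C - {tick C}"
  shows "loop_part w \<^bold>\<cdot> s w =\<^sub>B\<^sub>B\<^sub>P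
    stsum (map (\<lambda>\<tau>. Act (act \<tau>) \<^bold>\<cdot> s (tgt \<tau>)) (filter (\<lambda>\<tau>. l \<tau> \<ge> 1) (en w)))"
proof -
  have eq: "(Act (act \<tau>) \<^bold>\<cdot> t (tgt \<tau>) w) \<^bold>\<cdot> s w =\<^sub>B\<^sub>B\<^sub>P Act (act \<tau>) \<^bold>\<cdot> s (tgt \<tau>)"
    if "\<tau> \<in> set (en w)" "l \<tau> \<ge> 1" "tgt \<tau> \<noteq> w" for \<tau>
    using that assms descends_entry[of \<tau> C l]
    by (intro bbp_times_prefix t_times_s) (auto simp: set_en)
  define as where "as = map (\<lambda>\<tau>. Act (act \<tau>)) (filter (\<lambda>\<tau>. l \<tau> \<ge> 1 \<and> tgt \<tau> = w) (en w))"
  define bs where "bs = map (\<lambda>\<tau>. Act (act \<tau>) \<^bold>\<cdot> t (tgt \<tau>) w)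
    (filter (\<lambda>\<tau>. l \<tau> \<ge> 1 \<and> tgt \<tau> \<noteq> w) (en w))"
  show ?thesis
    unfolding loop_part_def as_def[symmetric] bs_def[symmetric]
  proof (intro bbp.trans[OF stsum_plus_times] stsum_eqI)
    fix x assume "x \<in> set (map (\<lambda>x. x \<^bold>\<cdot> s w) (as @ bs))"
    thus "\<exists>y\<in>set (map (\<lambda>\<tau>. Act (act \<tau>) \<^bold>\<cdot> s (tgt \<tau>)) (filter (\<lambda>\<tau>. l \<tau> \<ge> 1) (en w))). x =\<^sub>B\<^sub>B\<^sub>P y"
      using eq by (fastforce simp: as_def bs_def)
  next
    fix y assume "y \<in> set (map (\<lambda>\<tau>. Act (act \<tau>) \<^bold>\<cdot> s (tgt \<tau>)) (filter (\<lambda>\<tau>. l \<tau> \<ge> 1) (en w)))"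
    then obtain \<tau> where \<tau>: "\<tau> \<in> set (en w)" "l \<tau> \<ge> 1" "y = Act (act \<tau>) \<^bold>\<cdot> s (tgt \<tau>)" by auto
    show "\<exists>x\<in>set (map (\<lambda>x. x \<^bold>\<cdot> s w) (as @ bs)). x =\<^sub>B\<^sub>B\<^sub>P y"
    proof (cases "tgt \<tau> = w")
      case True
      with \<tau> have "y \<in> set (map (\<lambda>x. x \<^bold>\<cdot> s w) as)" by (force simp: as_def)
      thus ?thesis by force
    next
      case False
      with \<tau> have "(Act (act \<tau>) \<^bold>\<cdot> t (tgt \<tau>) w) \<^bold>\<cdot> s w \<in> set (map (\<lambda>x. x \<^bold>\<cdot> s w) bs)"
        by (force simp: bs_def)
      with eq[OF \<tau>(1,2) False] \<tau>(3) show ?thesis by force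
    qed
  qed
qed

lemma provable_solution_extraction: "provable_solution C s"
  unfolding provable_solution_def
proof (intro ballI allI impI, elim conjE)
  fix w as and bws :: "('a \<times> 'v) list"
  assume w: "w \<in> verts C - {tick C}"
    and listing: "{\<tau> \<in> transs C. src \<tau> = w} =
          {(w, a, tick C) | a. a \<in> set as} \<union> {(w, b, u) | b u. (b, u) \<in> set bws}"
    and no_tick: "\<forall>(b, u) \<in> set bws. u \<noteq> tick C"
  define es where "es = map (\<lambda>\<tau>. Act (act \<tau>) \<^bold>\<cdot> s (tgt \<tau>)) (filter (\<lambda>\<tau>. l \<tau> \<ge> 1) (en w))"
  \<comment> \<open>A self-loop ends in its source, and any other entry transition is a descent, so
    all transitions to \<open>tick\<close> are body transitions.\<close>
  have entry_tick: "tgt \<tau> \<noteq> tick C" if "\<tau> \<in> transs C" "l \<tau> \<ge> 1" for \<tau>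
    using descends_entry[of \<tau> C l] that descends_verts(2) trans_verts[OF that(1)]
    by (cases "tgt \<tau> = src \<tau>") auto
  have set_as: "set as = act ` {\<tau> \<in> transs C. src \<tau> = w \<and> tgt \<tau> = tick C}"
  \<comment> \<open>The nested comprehension exposes the set of transitions from \<open>w\<close>,
    so that \<open>listing\<close> can rewrite it.\<close>
  proof -
    have "{\<tau> \<in> transs C. src \<tau> = w \<and> tgt \<tau> = tick C} =
        {\<tau> \<in> {\<tau> \<in> transs C. src \<tau> = w}. tgt \<tau> = tick C}" by auto
    thus ?thesis unfolding listing using no_tick by force
  qed
  have set_bws: "set bws = (\<lambda>\<tau>. (act \<tau>, tgt \<tau>)) ` {\<tau> \<in> transs C. src \<tau> = w \<and> tgt \<tau> \<noteq> tick C}"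
  proof -
    have "{\<tau> \<in> transs C. src \<tau> = w \<and> tgt \<tau> \<noteq> tick C} =
        {\<tau> \<in> {\<tau> \<in> transs C. src \<tau> = w}. tgt \<tau> \<noteq> tick C}" by auto
    thus ?thesis unfolding listing using no_tick by force
  qed
  have "s w =\<^sub>B\<^sub>B\<^sub>P loop_part w \<^bold>* stsum (exit_summands w)" using w by (rule s_unfold)
  also have "loop_part w \<^bold>* stsum (exit_summands w) =\<^sub>B\<^sub>B\<^sub>P
      loop_part w \<^bold>\<cdot> (loop_part w \<^bold>* stsum (exit_summands w)) \<^bold>+ stsum (exit_summands w)"
    by (rule bbp.sym[OF bbp.BKS1])
  also have "\<dots> =\<^sub>B\<^sub>B\<^sub>P loop_part w \<^bold>\<cdot> s w \<^bold>+ stsum (exit_summands w)"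
    by (intro bbp.cong_plus bbp.cong_times bbp.refl bbp.sym[OF s_unfold] w)
  also have "\<dots> =\<^sub>B\<^sub>B\<^sub>P stsum es \<^bold>+ stsum (exit_summands w)"
    unfolding es_def by (intro bbp.cong_plus bbp.refl loop_part_times_s w)
  also have "\<dots> =\<^sub>B\<^sub>B\<^sub>P stsum (es @ exit_summands w)"
    by (rule bbp.sym[OF stsum_append])
  also have "stsum (es @ exit_summands w) =\<^sub>B\<^sub>B\<^sub>P
      stsum (map Act as @ map (\<lambda>(b, u). Act b \<^bold>\<cdot> s u) bws)"
  proof -
    \<comment> \<open>At this point the two sides have literally the same summands, up to order and
      repetition.\<close>
    have "set (es @ exit_summands w) = set (map Act as @ map (\<lambda>(b, u). Act b \<^bold>\<cdot> s u) bws)"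
    proof -
      \<comment> \<open>Regroups the summands, split so far into entry and body, by whether the
        target is \<open>tick\<close>; by \<open>entry_tick\<close> all entry transitions fall into
        \<open>?N\<close>.\<close>
      have "set (es @ exit_summands w) =
          (\<lambda>\<tau>. Act (act \<tau>)) ` {\<tau> \<in> transs C. src \<tau> = w \<and> tgt \<tau> = tick C} \<union>
          (\<lambda>\<tau>. Act (act \<tau>) \<^bold>\<cdot> s (tgt \<tau>)) ` {\<tau> \<in> transs C. src \<tau> = w \<and> tgt \<tau> \<noteq> tick C}"
        (is "_ = ?acts ` ?T \<union> ?steps ` ?N")
      proof -
        have "?T = {\<tau> \<in> set (en w). l \<tau> = 0 \<and> tgt \<tau> = tick C}"
          using entry_tick w by (force simp: set_en)
        moreover have "?N = {\<tau> \<in> set (en w). l \<tau> \<ge> 1} \<union> {\<tau> \<in> set (en w). l \<tau> = 0 \<and> tgt \<tau> \<noteq> tick C}"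
          using entry_tick w by (force simp: set_en)
        ultimately show ?thesis
          by (simp only: es_def exit_summands_def set_append set_map set_filter image_Un) blast
      qed
      thus ?thesis by (simp add: set_as set_bws image_image case_prod_beta)
    qed
    thus ?thesis by (intro stsum_eqI) (metis bbp.refl)+
  qed
  also have "\<dots> =\<^sub>B\<^sub>B\<^sub>P stsum (map Act as) \<^bold>+ stsum (map (\<lambda>(b, u). Act b \<^bold>\<cdot> s u) bws)"
    by (rule stsum_append)
  finally show "s w =\<^sub>B\<^sub>B\<^sub>P stsum (map Act as) \<^bold>+ stsum (map (\<lambda>(b, u). Act b \<^bold>\<cdot> s u) bws)" .
qed

end

theorem proposition5p5:
  fixes C :: "('v, 'a) chart"
    and l :: "('v, 'a) labeling"
    and en :: "'v \<Rightarrow> ('v, 'a) transition list"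
  assumes "is_chart C"
    and "LLEE_witness C l"
    and "transition_enum C en"
  shows "provable_solution C (extraction C l en)"
  using assms by (intro llee_chart.provable_solution_extraction llee_chart.intro)

end
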